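(* Let $N_{\rm sc}$ be even and let $x[0],\dots,x[N_{\rm sc}-1]$ be RO-QPSK symbols, with DFT-precoded subcarrier coefficients $X_k=\frac{1}{\sqrt{N_{\rm sc}}}\sum_{m=0}^{N_{\rm sc}-1}x[m]e^{-{\rm j}\frac{2\pi}{N_{\rm sc}}km}$. Then for all $k,h\in\{0,\dots,N_{\rm sc}-1\}$, $$\mathbb{E}[X_kX_h^*]=w_k\,\delta_{k-h},\qquad w_k=1-\cos\frac{2\pi k}{N_{\rm sc}},$$ where $\delta_0=1$ and $\delta_i=0$ for $i\neq0$.
   Context: Let ${\rm j}=\sqrt{-1}$. Bits $b_0,\dots,b_{N_{\rm sc}-1}\in\{0,1\}$ are i.i.d. equiprobable, $\alpha_m=\frac{1}{\sqrt2}(1-2b_m)$, with indices of $\alpha$ taken modulo $N_{\rm sc}$ (so $\alpha_{-1}=\alpha_{N_{\rm sc}-1}$). RO-QPSK (repeated-and-offset QPSK): for $N_{\rm sc}$ even, $x[m]=\alpha_m-{\rm j}\alpha_{m-1}$ if $m$ is even and $x[m]=-\alpha_{m-1}+{\rm j}\alpha_m$ if $m$ is odd, $0\le m\le N_{\rm sc}-1$. The superscript $^*$ denotes complex conjugation. *)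

theory Defs
  imports "HOL-Probability.Probability"
begin

text \<open>
  A bit sequence is a function \<open>b :: nat \<Rightarrow> nat\<close>; only the values at indices below \<open>N\<close> matter.
  The signal-level definitions below are deterministic functions of one realisation of the bits.
\<close>

text \<open>The index is an integer reduced modulo \<open>N\<close>, so that \<open>alpha N b (- 1) = alpha N b (int N - 1)\<close>.\<close>

definition alpha :: "nat \<Rightarrow> (nat \<Rightarrow> nat) \<Rightarrow> int \<Rightarrow> real" where
  "alpha N b i = 1 / sqrt 2 * (1 - 2 * real (b (nat (i mod int N))))"

definition ro_qpsk :: "nat \<Rightarrow> (nat \<Rightarrow> nat) \<Rightarrow> nat \<Rightarrow> complex" where
  "ro_qpsk N b m =
     (if even m
      then complex_of_real (alpha N b (int m)) - \<i> * complex_of_real (alpha N b (int m - 1))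
      else - complex_of_real (alpha N b (int m - 1)) + \<i> * complex_of_real (alpha N b (int m)))"

definition dft_precode :: "nat \<Rightarrow> (nat \<Rightarrow> complex) \<Rightarrow> nat \<Rightarrow> complex" where
  "dft_precode N x k =
     1 / complex_of_real (sqrt (real N)) *
       (\<Sum>m<N. x m * exp (- \<i> * complex_of_real (2 * pi / real N * real k * real m)))"

definition kdelta :: "int \<Rightarrow> real" where
  "kdelta i = (if i = 0 then 1 else 0)"

definition subcarrier_weight :: "nat \<Rightarrow> nat \<Rightarrow> real" where
  "subcarrier_weight N k = 1 - cos (2 * pi * real k / real N)"

text \<open>
  The bits \<open>b 0, \<dots>, b (N - 1)\<close> are independent random variables with values in \<open>{0, 1}\<close>, each
  uniformly distributed.  Independence (\<open>indep_vars\<close>) includes measurability into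
  \<open>count_space {0, 1}\<close>, hence that every \<open>b m\<close> takes values in \<open>{0, 1}\<close> everywhere on \<open>space M\<close>.
\<close>

definition iid_fair_bits :: "'a measure \<Rightarrow> nat \<Rightarrow> (nat \<Rightarrow> 'a \<Rightarrow> nat) \<Rightarrow> bool" where
  "iid_fair_bits M N b \<longleftrightarrow>
     prob_space.indep_vars M (\<lambda>_. count_space {0, 1}) b {..<N} \<and>
     (\<forall>m<N. distr M (count_space {0, 1}) (b m) = uniform_count_measure {0, 1})"

end

theory Submission
  imports Defs
begin

text \<open>
  Put \<open>u m = 1\<close> for even \<open>m\<close> and \<open>u m = \<i>\<close> for odd \<open>m\<close>.  Then \<open>x[m] = y[m] - y[m - 1]\<close> with
  \<open>y[m] = u m * \<alpha> m\<close>, and \<open>y\<close> is \<open>N\<close>-periodic because \<open>N\<close> is even.  A cyclic shift becomes a phase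
  factor under the DFT, so \<open>X k = (1 - q k) * Y k\<close> where \<open>q k = exp (- 2 \<pi> \<i> k / N)\<close>.
  The symbols \<open>y[m]\<close> are uncorrelated with variance \<open>1/2\<close>, hence so are the \<open>Y k\<close> by
  orthogonality of the characters, and \<open>\<bar>1 - q k\<bar>\<^sup>2 / 2 = 1 - cos (2 \<pi> k / N)\<close>.
\<close>

text \<open>Expanding both sums leaves expectations of \<open>A m * A n\<close> with constant
  coefficients. As \<open>A\<close> is real, conjugation affects only \<open>d\<close>, and only
  diagonal terms survive.\<close>

lemma (in prob_space) expectation_uncorrelated_linear_combinations:
  fixes A :: "'i \<Rightarrow> 'a \<Rightarrow> real" and c d :: "'i \<Rightarrow> complex"
  assumes integrable: "\<And>m n. m \<in> I \<Longrightarrow> n \<in> I \<Longrightarrow> integrable M (\<lambda>\<omega>. A m \<omega> * A n \<omega>)"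
    and cov: "\<And>m n. m \<in> I \<Longrightarrow> n \<in> I \<Longrightarrow>
      expectation (\<lambda>\<omega>. A m \<omega> * A n \<omega>) = (if m = n then v else 0)"
    and "finite I"
  shows "expectation (\<lambda>\<omega>. (\<Sum>m\<in>I. of_real (A m \<omega>) * c m) * cnj (\<Sum>n\<in>I. of_real (A n \<omega>) * d n))
    = of_real v * (\<Sum>m\<in>I. c m * cnj (d m))"
proof -
  have "expectation (\<lambda>\<omega>. (\<Sum>m\<in>I. of_real (A m \<omega>) * c m) * cnj (\<Sum>n\<in>I. of_real (A n \<omega>) * d n))
    = expectation (\<lambda>\<omega>. \<Sum>m\<in>I. \<Sum>n\<in>I. complex_of_real (A m \<omega> * A n \<omega>) * (c m * cnj (d n)))"
    by (simp add: sum_product mult_ac)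
  also have "\<dots> = (\<Sum>m\<in>I. \<Sum>n\<in>I. expectation (\<lambda>\<omega>. complex_of_real (A m \<omega> * A n \<omega>)) * (c m * cnj (d n)))"
  proof -
    have int: "integrable M (\<lambda>\<omega>. complex_of_real (A m \<omega> * A n \<omega>) * (c m * cnj (d n)))"
      if "m \<in> I" "n \<in> I" for m n
      using integrable[OF that] by (intro integrable_mult_left integrable_of_real)
    show ?thesis
      by (simp add: Bochner_Integration.integral_sum int del: of_real_mult)
  qed
  also have "\<dots> = (\<Sum>m\<in>I. \<Sum>n\<in>I. of_real (if m = n then v else 0) * (c m * cnj (d n)))"
    by (intro sum.cong refl) (simp add: cov integral_complex_of_real del: of_real_mult)
  also have "\<dots> = (\<Sum>m\<in>I. of_real v * (c m * cnj (d m)))"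
    by (intro sum.cong refl) (simp add: if_distrib if_distribR sum.delta \<open>finite I\<close> cong: if_cong)
  finally show ?thesis
    by (simp add: sum_distrib_left)
qed

text \<open>On the diagonal the product is constant on \<open>space M\<close>, since a bit decides
  only the sign of \<open>alpha\<close>; off the diagonal, independence factors the expectation into
  two zero means.\<close>

lemma alpha_second_moments:
  assumes "prob_space M" and bits: "iid_fair_bits M N b" and "m < N" "n < N"
  defines "A \<equiv> \<lambda>m \<omega>. alpha N (\<lambda>j. b j \<omega>) (int m)"
  shows "integrable M (\<lambda>\<omega>. A m \<omega> * A n \<omega>)" (is ?int)
    and "prob_space.expectation M (\<lambda>\<omega>. A m \<omega> * A n \<omega>) = (if m = n then 1/2 else 0)" (is ?eq)
proof -
  interpret prob_space M by fact
  define s :: "nat \<Rightarrow> real" where "s x = 1 / sqrt 2 * (1 - 2 * real x)" for x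
  have A_eq: "A j \<omega> = s (b j \<omega>)" if "j < N" for j \<omega>
    using that by (simp add: A_def alpha_def s_def flip: zmod_int)
  have indep: "indep_vars (\<lambda>_. count_space {0, 1}) b {..<N}"
    using bits by (simp add: iid_fair_bits_def)
  have distr: "distr M (count_space {0, 1}) (b j) = uniform_count_measure {0, 1}" if "j < N" for j
    using bits that by (simp add: iid_fair_bits_def)
  have b_meas: "b j \<in> measurable M (count_space {0, 1})" if "j < N" for j
    using indep that by (auto simp: indep_vars_def)
  have b_cases: "b j \<omega> = 0 \<or> b j \<omega> = 1" if "j < N" "\<omega> \<in> space M" for j \<omega>
    using measurable_space[OF b_meas[OF that(1)] that(2)] by auto
  have s_meas: "(\<lambda>\<omega>. s (b j \<omega>)) \<in> borel_measurable M" if "j < N" for j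
    using measurable_compose[OF b_meas[OF that], of s borel] by simp
  \<comment> \<open>The bound 1 works because \<open>s\<close> has modulus \<open>1 / sqrt 2\<close>
    at either bit value.\<close>
  have s_int: "integrable M (\<lambda>\<omega>. s (b j \<omega>))" if "j < N" for j
    using b_cases[OF that]
    by (intro integrable_const_bound[of _ 1] AE_I2 s_meas that) (force simp: s_def)
  \<comment> \<open>The two equally likely values cancel: \<open>s 0 + s 1 = 0\<close>.\<close>
  have s_mean: "expectation (\<lambda>\<omega>. s (b j \<omega>)) = 0" if "j < N" for j
    using integral_distr[OF b_meas[OF that], of s] distr[OF that]
    by (simp add: integral_uniform_count_measure s_def)
  have "?int \<and> ?eq"
  proof (cases "m = n")
    case True
    have "A m \<omega> * A n \<omega> = 1/2" if "\<omega> \<in> space M" for \<omega>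
      using b_cases[OF \<open>m < N\<close> that] True \<open>m < N\<close> by (auto simp: A_eq s_def)
    then have "integrable M (\<lambda>\<omega>. A m \<omega> * A n \<omega>) = integrable M (\<lambda>\<omega>. 1/2 :: real)"
      "expectation (\<lambda>\<omega>. A m \<omega> * A n \<omega>) = expectation (\<lambda>\<omega>. 1/2)"
      by (intro Bochner_Integration.integrable_cong Bochner_Integration.integral_cong refl; simp)+
    then show ?thesis
      using True by (simp add: prob_space)
  next
    case False
    have "indep_vars (\<lambda>_. borel) (\<lambda>j \<omega>. s (b j \<omega>)) {..<N}"
      using indep by (rule indep_vars_compose2) simp
    \<comment> \<open>As \<open>m\<close> and \<open>n\<close> differ, a product over
      \<open>{m, n}\<close> is a plain product of two factors.\<close>
    then have "indep_vars (\<lambda>_. borel) (\<lambda>j \<omega>. s (b j \<omega>)) {m, n}"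
      using \<open>m < N\<close> \<open>n < N\<close> by (auto intro: indep_vars_subset)
    from indep_vars_lebesgue_integral[OF _ this] indep_vars_integrable[OF _ this]
    show ?thesis
      using False \<open>m < N\<close> \<open>n < N\<close> s_int s_mean by (auto simp: A_eq)
  qed
  then show ?int ?eq by blast+
qed

definition ro_phase :: "nat \<Rightarrow> complex" where
  "ro_phase m = (if even m then 1 else \<i>)"

text \<open>This is the root of unity \<open>q k\<close>; \<open>cis\<close> gives powers by De
  Moivre and a cosine as real part.\<close>

definition twiddle :: "nat \<Rightarrow> nat \<Rightarrow> complex" where
  "twiddle N k = cis (- (2 * pi * real k / real N))"

lemma twiddle_power_period: "0 < N \<Longrightarrow> twiddle N k ^ N = 1"
  using cis_multiple_2pi[of "- real k"] by (simp add: twiddle_def Complex.DeMoivre)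

text \<open>Cyclic reindexing: the wrapped term \<open>g (- 1) * q ^ 0\<close> equals
  \<open>g (int N - 1) * q ^ N\<close>, the last term of the right-hand side.\<close>

lemma sum_shift_times_power:
  fixes g :: "int \<Rightarrow> 'a::comm_ring_1"
  assumes "q ^ N = 1" and "g (- 1) = g (int N - 1)"
  shows "(\<Sum>m<N. g (int m - 1) * q ^ m) = q * (\<Sum>m<N. g (int m) * q ^ m)"
proof (cases N)
  case (Suc n)
  have "(\<Sum>m<N. g (int m - 1) * q ^ m) = g (int n) * q ^ N + (\<Sum>m<n. g (int m) * q ^ Suc m)"
    unfolding Suc using assms by (subst sum.lessThan_Suc_shift) (simp add: Suc)
  also have "\<dots> = (\<Sum>m<N. g (int m) * q ^ Suc m)"
    by (simp add: Suc)
  finally show ?thesis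
    by (simp add: sum_distrib_left mult_ac)
qed simp

text \<open>This separates the random real factors, common to all \<open>k\<close>, from
  deterministic coefficients, as the expectation of a product of two linear combinations
  requires.\<close>

lemma dft_precode_ro_qpsk:
  assumes "even N" "0 < N"
  shows "dft_precode N (ro_qpsk N b) k =
    (\<Sum>m<N. of_real (alpha N b (int m)) *
      ((1 - twiddle N k) / of_real (sqrt N) * ro_phase m * twiddle N k ^ m))"
proof -
  \<comment> \<open>Integer indices let \<open>m - 1\<close> reach \<open>- 1\<close> at
    \<open>m = 0\<close>, with the parity of an odd index.\<close>
  define y :: "int \<Rightarrow> complex"
    where "y i = (if even i then 1 else \<i>) * of_real (alpha N b i)" for i
  have x: "ro_qpsk N b m = y (int m) - y (int m - 1)" for m
    by (auto simp: ro_qpsk_def y_def)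
  \<comment> \<open>For even \<open>N\<close>, \<open>int N - 1\<close> is odd like
    \<open>- 1\<close>, so the phases agree; \<open>alpha\<close> is periodic by its
    modulus.\<close>
  have y_periodic: "y (- 1) = y (int N - 1)"
    using assms by (simp add: y_def alpha_def zmod_minus1)
  have e: "exp (- \<i> * complex_of_real (2 * pi / real N * real k * real m)) = twiddle N k ^ m" for m :: nat
    unfolding twiddle_def Complex.DeMoivre by (simp add: cis_conv_exp mult_ac)
  have "dft_precode N (ro_qpsk N b) k =
      1 / of_real (sqrt N) * ((\<Sum>m<N. y (int m) * twiddle N k ^ m)
        - (\<Sum>m<N. y (int m - 1) * twiddle N k ^ m))"
    unfolding dft_precode_def e by (simp add: x left_diff_distrib sum_subtractf)
  also have "\<dots> = (1 - twiddle N k) / of_real (sqrt N) * (\<Sum>m<N. y (int m) * twiddle N k ^ m)"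
    unfolding sum_shift_times_power[of "twiddle N k" N y, OF twiddle_power_period[OF assms(2)] y_periodic]
    by (simp add: algebra_simps diff_divide_distrib)
  finally show ?thesis
    by (simp add: sum_distrib_left y_def ro_phase_def mult_ac)
qed

text \<open>The sum is geometric with ratio an \<open>N\<close>-th root of unity, which equals 1
  only if \<open>N\<close> divides \<open>h - k\<close>.\<close>

lemma sum_twiddle_orthogonal:
  assumes "k < N" "h < N"
  shows "(\<Sum>m<N. twiddle N k ^ m * cnj (twiddle N h ^ m)) = (if k = h then of_nat N else 0)"
proof -
  define z where "z = twiddle N k * cnj (twiddle N h)"
  have sum_z: "(\<Sum>m<N. twiddle N k ^ m * cnj (twiddle N h ^ m)) = (\<Sum>m<N. z ^ m)"
    by (simp add: z_def power_mult_distrib)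
  have z_cis: "z = cis (2 * pi * (real h - real k) / real N)"
    by (simp add: z_def twiddle_def cis_cnj cis_mult diff_divide_distrib right_diff_distrib)
  show ?thesis
  proof (cases "k = h")
    case False
    have "z \<noteq> 1"
    proof
      assume "z = 1"
      then have "cos (2 * pi * (real h - real k) / real N) = 1"
        unfolding z_cis by (metis cis.sel(1) one_complex.sel(1))
      then obtain i :: int where "2 * pi * (real h - real k) / real N = real_of_int i * 2 * pi"
        unfolding cos_one_2pi_int by blast
      then have "(real h - real k) * (2 * pi) = (real_of_int i * real N) * (2 * pi)"
        using assms by (simp add: divide_eq_eq mult_ac)
      then have "real h - real k = real_of_int i * real N"
        by simp
      then have "int h - int k = i * int N"
        by (metis of_int_diff of_int_eq_iff of_int_mult of_int_of_nat_eq)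
      moreover have "\<bar>int h - int k\<bar> < int N"
        using assms by linarith
      \<comment> \<open>If \<open>i = 0\<close> then \<open>h = k\<close>; otherwise
        \<open>N\<close> divides a nonzero integer of modulus below \<open>N\<close>.\<close>
      ultimately show False
        using False assms dvd_imp_le_int[of "int h - int k" "int N"] by (cases "i = 0") auto
    qed
    moreover have "z ^ N = 1"
      using assms twiddle_power_period[of N] by (simp add: z_def power_mult_distrib flip: complex_cnj_power)
    ultimately show ?thesis
      unfolding sum_z using False geometric_sum[of z N] by simp
  next
    case True
    then show ?thesis
      unfolding sum_z z_cis by simp
  qed
qed

theorem lemma1:
  fixes M :: "'a measure" and N :: nat and b :: "nat \<Rightarrow> 'a \<Rightarrow> nat"
    and X :: "nat \<Rightarrow> 'a \<Rightarrow> complex"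
  assumes "prob_space M"
    and "even N"
    and "iid_fair_bits M N b"
    and X: "\<And>k \<omega>. X k \<omega> = dft_precode N (ro_qpsk N (\<lambda>m. b m \<omega>)) k"
  shows "\<forall>k\<in>{0..<N}. \<forall>h\<in>{0..<N}.
           prob_space.expectation M (\<lambda>\<omega>. X k \<omega> * cnj (X h \<omega>)) =
             complex_of_real (subcarrier_weight N k * kdelta (int k - int h))"
proof (intro ballI)
  fix k h assume "k \<in> {0..<N}" "h \<in> {0..<N}"
  then have kh: "k < N" "h < N" "0 < N" by auto
  interpret prob_space M by fact
  define c where "c k m = (1 - twiddle N k) / of_real (sqrt N) * ro_phase m * twiddle N k ^ m" for k m
  have phase: "ro_phase m * cnj (ro_phase m) = 1" for m
    by (simp add: ro_phase_def)
  have sqrt_sq: "complex_of_real (sqrt N) * of_real (sqrt N) = of_nat N"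
    by (metis of_nat_0_le_iff of_real_mult of_real_of_nat_eq real_sqrt_mult_self abs_of_nonneg)
  have "expectation (\<lambda>\<omega>. X k \<omega> * cnj (X h \<omega>)) = of_real (1/2) * (\<Sum>m<N. c k m * cnj (c h m))"
    unfolding X dft_precode_ro_qpsk[OF \<open>even N\<close> \<open>0 < N\<close>] c_def
    by (intro expectation_uncorrelated_linear_combinations alpha_second_moments assms) auto
  also have "(\<Sum>m<N. c k m * cnj (c h m)) = (\<Sum>m<N. (1 - twiddle N k) * cnj (1 - twiddle N h) / of_nat N *
      (ro_phase m * cnj (ro_phase m)) * (twiddle N k ^ m * cnj (twiddle N h ^ m)))"
    by (simp add: c_def mult_ac flip: sqrt_sq)
  also have "\<dots> = (1 - twiddle N k) * cnj (1 - twiddle N h) / of_nat N *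
      (if k = h then of_nat N else 0)"
    unfolding phase mult_1_right sum_distrib_left[symmetric] sum_twiddle_orthogonal[OF kh(1,2)] ..
  also have "of_real (1/2) * \<dots> = complex_of_real (subcarrier_weight N k * kdelta (int k - int h))"
  proof (cases "k = h")
    case True
    \<comment> \<open>The factor 2 cancels the variance \<open>1/2\<close>; \<open>t\<close> will be
      the negative angle in \<open>twiddle\<close>, and cosine is even.\<close>
    have "(1 - cis t) * cnj (1 - cis t) = complex_of_real (2 * (1 - cos t))" for t
      using sin_cos_squared_add[of t]
      by (simp add: complex_eq_iff power2_eq_square algebra_simps)
    then show ?thesis
      using True kh by (simp add: twiddle_def subcarrier_weight_def kdelta_def)
  qed (simp add: kdelta_def)
  finally show "expectation (\<lambda>\<omega>. X k \<omega> * cnj (X h \<omega>)) =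
      complex_of_real (subcarrier_weight N k * kdelta (int k - int h))" .
qed

end
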